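(* Let $m\ge1$ be a fixed integer and $G_n\sim\mathcal{PA}(m;n)$. Then, with probability at least $1-o(n^{-1})$ as $n\to\infty$, the height of $\mathrm{DAG}(G_n)$ is at most $Cm\log n$, for some absolute positive constant $C$.
   Context: Preferential attachment model: for an integer $m\ge 1$, $\mathcal{PA}(m;n)$ is the distribution of the random multigraph $G_n$ on vertex set $[n]=\{1,\dots,n\}$ built recursively as follows. $G_1$ is the single vertex $1$ with $m$ self-loops (these are the only self-loops in the graph, and each is counted once in the degree of vertex $1$). Given $G_n$, add vertex $n+1$ and let it make $m$ random choices $v_1,\dots,v_m\in[n]$ of neighbors with $$P(v_i = w \mid G_n, v_1,\dots,v_{i-1}) = \frac{\deg_n(w)}{\sum_{u\in[n]}\deg_n(u)} = \frac{\deg_n(w)}{2mn-m},\qquad w\in[n],$$ where $\deg_n(w)$ is the degree of $w$ in $G_n$ (multiplicities counted); one edge joins $n+1$ to each $v_i$, so multiple edges may occur. The result is $G_{n+1}\sim\mathcal{PA}(m;n+1)$. $\mathrm{DAG}(G)$ is the directed version of $G$ on the same vertex set: each edge of $G$ between $u$ and $v<u$ is directed from $u$ to $v$. Self-loops are ignored, so this is a directed acyclic graph. Its height is the length of a longest directed path. *)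

theory Defs
  imports
    "HOL-Probability.Probability"
    "HOL-Library.Uprod"
    "HOL-Library.Landau_Symbols"
    "Graph_Theory.Arc_Walk"
begin

record 'a multigraph =
  mverts :: "'a set"
  medges :: "'a uprod multiset"

text \<open>Parallel edges are counted with multiplicity; a self-loop contributes 1, not 2.\<close>

definition mdeg :: "'a multigraph \<Rightarrow> 'a \<Rightarrow> nat" where
  "mdeg G w = size {#e \<in># medges G. w \<in> set_uprod e#}"

text \<open>Meaningful only if \<open>mverts G\<close> is finite and some vertex has positive degree;
  see \<open>pmf_choose_nbr\<close> below.\<close>

definition choose_nbr :: "'a multigraph \<Rightarrow> 'a pmf" where
  "choose_nbr G = embed_pmf (\<lambda>w. if w \<in> mverts G
     then real (mdeg G w) / real (\<Sum>u\<in>mverts G. mdeg G u) else 0)"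

definition add_vertex :: "'a multigraph \<Rightarrow> 'a \<Rightarrow> 'a list \<Rightarrow> 'a multigraph" where
  "add_vertex G x vs = \<lparr>mverts = insert x (mverts G),
     medges = medges G + mset (map (Upair x) vs)\<rparr>"

text \<open>The degrees governing the \<open>m\<close> choices of a new vertex are those of the graph before the
  vertex is added, so the choices are independent and identically distributed given that graph.
  The case \<open>n = 0\<close> is a dummy value.\<close>

fun pref_attach :: "nat \<Rightarrow> nat \<Rightarrow> nat multigraph pmf" where
  "pref_attach m 0 = return_pmf \<lparr>mverts = {}, medges = {#}\<rparr>"
| "pref_attach m (Suc 0) =
     return_pmf \<lparr>mverts = {1}, medges = replicate_mset m (Upair 1 1)\<rparr>"
| "pref_attach m (Suc (Suc n)) = do {
     G \<leftarrow> pref_attach m (Suc n);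
     vs \<leftarrow> replicate_pmf m (choose_nbr G);
     return_pmf (add_vertex G (Suc (Suc n)) vs)
   }"

text \<open>An arc \<open>(u, v, k)\<close> goes from \<open>u\<close> to \<open>v\<close>; the index \<open>k\<close> tells parallel arcs apart.\<close>

definition DAG :: "'a::linorder multigraph \<Rightarrow> ('a, 'a \<times> 'a \<times> nat) pre_digraph" where
  "DAG G = \<lparr>verts = mverts G,
     arcs = {(u, v, k). v < u \<and> k < count (medges G) (Upair u v)},
     tail = (\<lambda>(u, v, k). u),
     head = (\<lambda>(u, v, k). v)\<rparr>"

definition dag_height :: "('a, 'b) pre_digraph \<Rightarrow> nat" where
  "dag_height D = Max {length p | u p v. pre_digraph.apath D u p v}"

lemma pmf_choose_nbr:
  assumes "finite (mverts G)" "(\<Sum>u\<in>mverts G. mdeg G u) > 0"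
  shows "pmf (choose_nbr G) w = (if w \<in> mverts G
     then real (mdeg G w) / real (\<Sum>u\<in>mverts G. mdeg G u) else 0)"
  unfolding choose_nbr_def
proof (rule pmf_embed_pmf)
  let ?s = "real (\<Sum>u\<in>mverts G. mdeg G u)"
  let ?f = "\<lambda>w. if w \<in> mverts G then real (mdeg G w) / ?s else 0"
  show "\<And>x. 0 \<le> ?f x" by (simp add: sum_nonneg)
  have "(\<integral>\<^sup>+x. ennreal (?f x) \<partial>count_space UNIV)
      = (\<integral>\<^sup>+x. ennreal (real (mdeg G x) / ?s) \<partial>count_space (mverts G))"
    by (subst nn_integral_count_space_indicator)
       (auto intro!: nn_integral_cong split: split_indicator)
  also have "\<dots> = (\<Sum>x\<in>mverts G. ennreal (real (mdeg G x) / ?s))"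
    using assms(1) by (rule nn_integral_count_space_finite)
  also have "\<dots> = ennreal (\<Sum>x\<in>mverts G. real (mdeg G x) / ?s)"
    by (rule sum_ennreal) (simp add: sum_nonneg)
  also have "(\<Sum>x\<in>mverts G. real (mdeg G x) / ?s) = ?s / ?s"
    by (simp only: of_nat_sum sum_divide_distrib)
  also have "?s / ?s = 1" using assms(2) by (metis divide_self of_nat_0_eq_iff less_irrefl)
  finally show "(\<integral>\<^sup>+x. ennreal (?f x) \<partial>count_space UNIV) = 1" by simp
qed

lemma sum_mdeg:
  assumes "finite (mverts G)" "\<And>e. e \<in># medges G \<Longrightarrow> set_uprod e \<subseteq> mverts G"
  shows "(\<Sum>u\<in>mverts G. mdeg G u) = (\<Sum>e\<in>#medges G. card (set_uprod e))"
proof -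
  have "(\<Sum>u\<in>V. size {#e \<in># E. u \<in> set_uprod e#}) = (\<Sum>e\<in>#E. card (set_uprod e))"
    if "finite V" "\<And>e. e \<in># E \<Longrightarrow> set_uprod e \<subseteq> V" for V and E :: "'a uprod multiset"
    using that(2)
  proof (induction E)
    case empty
    then show ?case by simp
  next
    case (add e E)
    have "(\<Sum>u\<in>V. size {#x \<in># add_mset e E. u \<in> set_uprod x#})
        = (\<Sum>u\<in>V. (if u \<in> set_uprod e then 1 else 0) + size {#x \<in># E. u \<in> set_uprod x#})"
      by (intro sum.cong) auto
    also have "\<dots> = card (V \<inter> set_uprod e) + (\<Sum>e\<in>#E. card (set_uprod e))"
      using that(1) add by (simp add: sum.distrib sum.If_cases Int_def)
    also have "V \<inter> set_uprod e = set_uprod e" using add.prems by auto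
    finally show ?case by simp
  qed
  then show ?thesis using assms unfolding mdeg_def by blast
qed

lemma pref_attach_support:
  assumes "m \<ge> 1" "G \<in> set_pmf (pref_attach m (Suc n))"
  shows "mverts G = {1..Suc n}"
    and "\<And>e. e \<in># medges G \<Longrightarrow> set_uprod e \<subseteq> mverts G"
    and "(\<Sum>u\<in>mverts G. mdeg G u) = 2 * m * Suc n - m"
proof -
  have "mverts G = {1..Suc n} \<and> (\<forall>e\<in>#medges G. set_uprod e \<subseteq> mverts G)
      \<and> (\<Sum>u\<in>mverts G. mdeg G u) = 2 * m * Suc n - m"
    using assms(2)
  proof (induction n arbitrary: G)
    case 0
    have "(\<Sum>u\<in>mverts G. mdeg G u) = m"
      using 0 by (subst sum_mdeg) (auto split: if_splits simp: in_replicate_mset)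
    with 0 show ?case by (auto split: if_splits simp: in_replicate_mset)
  next
    case (Suc n)
    obtain H vs where H: "H \<in> set_pmf (pref_attach m (Suc n))"
      and vs: "vs \<in> set_pmf (replicate_pmf m (choose_nbr H))"
      and G: "G = add_vertex H (Suc (Suc n)) vs"
      using Suc.prems by auto
    note IH = Suc.IH[OF H]
    have "2 * m * Suc n - m > 0" using assms(1) by simp
    then have pos: "(\<Sum>u\<in>mverts H. mdeg H u) > 0" using IH by metis
    have fin: "finite (mverts H)" using IH by simp
    have "set_pmf (choose_nbr H) \<subseteq> mverts H"
      by (auto simp: set_pmf_iff pmf_choose_nbr[OF fin pos] split: if_splits)
    with vs have vs': "set vs \<subseteq> mverts H" "length vs = m"
      by (auto simp: set_replicate_pmf)
    have V: "mverts G = {1..Suc (Suc n)}"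
      using IH by (auto simp: G add_vertex_def)
    have E: "\<forall>e\<in>#medges G. set_uprod e \<subseteq> mverts G"
      using IH vs'(1) by (auto simp: G add_vertex_def)
    have "(\<Sum>e\<in>#mset (map (Upair x) xs). card (set_uprod e)) = 2 * length xs"
      if "x \<notin> set xs" for x :: nat and xs
      using that by (induction xs) (auto simp: card_insert_if)
    moreover have "Suc (Suc n) \<notin> set vs" using vs'(1) IH by auto
    ultimately have "(\<Sum>e\<in>#mset (map (Upair (Suc (Suc n))) vs). card (set_uprod e)) = 2 * m"
      using vs'(2) by blast
    moreover have "(\<Sum>u\<in>mverts G. mdeg G u) = (\<Sum>e\<in>#medges G. card (set_uprod e))"
      using V E by (intro sum_mdeg) auto
    moreover have "(\<Sum>u\<in>mverts H. mdeg H u) = (\<Sum>e\<in>#medges H. card (set_uprod e))"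
      using IH by (intro sum_mdeg) auto
    moreover have "(\<Sum>u\<in>mverts H. mdeg H u) = 2 * m * Suc n - m"
      using IH by blast
    moreover have "(\<Sum>e\<in>#medges G. card (set_uprod e)) = (\<Sum>e\<in>#medges H. card (set_uprod e))
        + (\<Sum>e\<in>#mset (map (Upair (Suc (Suc n))) vs). card (set_uprod e))"
      by (simp add: G add_vertex_def)
    moreover have "2 * m * Suc n - m + 2 * m = 2 * m * Suc (Suc n) - m"
      by simp
    ultimately have "(\<Sum>u\<in>mverts G. mdeg G u) = 2 * m * Suc (Suc n) - m"
      by presburger
    with V E show ?case by blast
  qed
  then show "mverts G = {1..Suc n}"
    and "\<And>e. e \<in># medges G \<Longrightarrow> set_uprod e \<subseteq> mverts G"
    and "(\<Sum>u\<in>mverts G. mdeg G u) = 2 * m * Suc n - m"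
    by auto
qed

lemma fin_digraph_DAG:
  assumes "finite (mverts G)" "\<And>e. e \<in># medges G \<Longrightarrow> set_uprod e \<subseteq> mverts G"
  shows "fin_digraph (DAG G)"
proof
  have *: "u \<in> mverts G \<and> v \<in> mverts G" if "k < count (medges G) (Upair u v)" for u v k
  proof -
    have "Upair u v \<in># medges G"
      using that by (metis count_eq_zero_iff not_less0)
    from assms(2)[OF this] show ?thesis by simp
  qed
  show "tail (DAG G) e \<in> verts (DAG G)" if "e \<in> arcs (DAG G)" for e
    using that * by (auto simp: DAG_def)
  show "head (DAG G) e \<in> verts (DAG G)" if "e \<in> arcs (DAG G)" for e
    using that * by (auto simp: DAG_def)
  show "finite (verts (DAG G))" using assms(1) by (simp add: DAG_def)
  have "arcs (DAG G) \<subseteq> mverts G \<times> mverts G \<times> {..<size (medges G)}"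
    using * by (auto simp: DAG_def intro: less_le_trans[OF _ count_le_size])
  then show "finite (arcs (DAG G))"
    by (rule finite_subset) (simp add: assms(1))
qed

lemma dag_height_attained:
  assumes "fin_digraph D" "verts D \<noteq> {}"
  shows "finite {length p | u p v. pre_digraph.apath D u p v}"
    and "{length p | u p v. pre_digraph.apath D u p v} \<noteq> {}"
proof -
  interpret fin_digraph D by fact
  have "{length p | u p v. apath u p v} = (\<lambda>(u, p, v). length p) ` {(u, p, v). apath u p v}"
    by force
  then show "finite {length p | u p v. apath u p v}"
    using apaths_finite_triple by simp
  obtain u where "u \<in> verts D" using assms(2) by blast
  then have "apath u [] u" by (simp add: apath_Nil_iff)
  then show "{length p | u p v. apath u p v} \<noteq> {}" by blast
qed

end

theory Submission
  imports Defs "HOL-Real_Asymp.Real_Asymp"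
begin

text \<open>
  The proof is a first-moment argument for an exponential potential. For a vertex \<open>u\<close> let
  \<open>depth G u\<close> be the length of a longest directed path starting at \<open>u\<close>, and let
  \<open>\<Phi>(G) = (\<Sum>u. deg(u) * exp (depth G u))\<close>. Since a new vertex chooses its neighbours with
  probability proportional to the degree, the mean of \<open>exp (depth w)\<close> over one choice \<open>w\<close> is
  \<open>\<Phi>(G)\<close> divided by the total degree: the weights in \<open>\<Phi>\<close> are the law of the choice up to scaling.

  Arcs go from younger to older vertices, so a new vertex \<open>x\<close> does not change the depth of the
  others, and its own depth is one more than the largest depth of its choices
  \<open>w\<^sub>1, \<dots>, w\<^sub>m\<close>. Bounding the maximum by a sum, \<open>\<Phi>\<close> grows by at most
  \<open>(1 + m e) * (\<Sum>i. exp (depth w\<^sub>i))\<close> (\<open>potential_add_vertex_le\<close>), where the summand 1 stands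
  for the increased degree of \<open>w\<^sub>i\<close> and \<open>m e\<close> for the contribution of \<open>x\<close>. Taking means, the
  expected potential is multiplied by at most \<open>1 + (1 + m e) / (2n - 1)\<close> when the graph has
  \<open>n\<close> vertices (\<open>expected_potential_step\<close>), and so it is at most \<open>m n\<^sup>1\<^sup>+\<^sup>3\<^sup>m\<close>
  (\<open>expected_potential_le\<close>).

  All degrees are positive, so a path of length greater than \<open>6 m ln n\<close> forces
  \<open>\<Phi>(G) \<ge> n\<^sup>6\<^sup>m\<close> (\<open>exp_dag_height_le_potential\<close>). By Markov's inequality this has probability
  at most \<open>m n\<^sup>1\<^sup>+\<^sup>3\<^sup>m / n\<^sup>6\<^sup>m \<le> m / n\<^sup>2\<close>. Summing over vertices weighted by their
  degrees takes the place of a union bound over paths.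
\<close>

section \<open>Depth of a vertex\<close>

text \<open>The recursion runs along the order of the vertices, which makes it evident that adding a
  larger vertex leaves the depth of the smaller ones unchanged.\<close>

function depth :: "nat multigraph \<Rightarrow> nat \<Rightarrow> nat" where
  "depth G u = Max (insert 0 ((\<lambda>v. Suc (depth G v)) ` {v. v < u \<and> Upair u v \<in># medges G}))"
  by auto
termination by (relation "inv_image less_than snd") auto

declare depth.simps [simp del]

lemma depth_less:
  assumes "v < u" "Upair u v \<in># medges G"
  shows "depth G v < depth G u"
proof -
  have "Suc (depth G v) \<le> depth G u"
    unfolding depth.simps[of G u] using assms by (intro Max_ge) auto
  then show ?thesis by simp
qed

lemma length_le_depth:
  assumes "pre_digraph.awalk (DAG G) u p v"
  shows "length p \<le> depth G u"
proof -
  have "set p \<subseteq> arcs (DAG G) \<Longrightarrow> pre_digraph.cas (DAG G) u p v \<Longrightarrow> length p \<le> depth G u"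
  proof (induction p arbitrary: u)
    case Nil
    then show ?case by simp
  next
    case (Cons e p)
    obtain a b k where e: "e = (a, b, k)" by (cases e)
    have a: "a = u" and ab: "b < u" "k < count (medges G) (Upair u b)"
      and p: "pre_digraph.cas (DAG G) b p v"
      using Cons.prems by (auto simp: e pre_digraph.cas.simps DAG_def)
    have "Upair u b \<in># medges G" using ab(2) by (metis count_eq_zero_iff not_less0)
    from depth_less[OF ab(1) this] Cons.IH[of b] p Cons.prems(1) show ?case by auto
  qed
  then show ?thesis using assms by (simp add: pre_digraph.awalk_def)
qed

lemma dag_height_le_depth:
  assumes "fin_digraph (DAG G)" "mverts G \<noteq> {}"
  shows "\<exists>u\<in>mverts G. dag_height (DAG G) \<le> depth G u"
proof -
  have "verts (DAG G) \<noteq> {}" using assms(2) by (simp add: DAG_def)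
  from dag_height_attained[OF assms(1) this]
  have "dag_height (DAG G) \<in> {length p | u p v. pre_digraph.apath (DAG G) u p v}"
    unfolding dag_height_def by (rule Max_in)
  then obtain u p v where *: "pre_digraph.awalk (DAG G) u p v" "dag_height (DAG G) = length p"
    by (auto simp: pre_digraph.apath_def)
  then have "u \<in> mverts G" by (simp add: pre_digraph.awalk_def DAG_def)
  with * length_le_depth[OF *(1)] show ?thesis by auto
qed

lemma depth_add_vertex_old:
  assumes "u < x"
  shows "depth (add_vertex G x vs) u = depth G u"
  using assms
proof (induction u rule: less_induct)
  case (less u)
  have "{v. v < u \<and> Upair u v \<in># medges (add_vertex G x vs)}
      = {v. v < u \<and> Upair u v \<in># medges G}"
    using less.prems by (auto simp: add_vertex_def)
  moreover have "(\<lambda>v. Suc (depth (add_vertex G x vs) v)) ` {v. v < u \<and> Upair u v \<in># medges G}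
      = (\<lambda>v. Suc (depth G v)) ` {v. v < u \<and> Upair u v \<in># medges G}"
    using less by (intro image_cong) auto
  ultimately show ?case by (simp add: depth.simps[of _ u])
qed

lemma depth_add_vertex_new:
  assumes "\<And>e. e \<in># medges G \<Longrightarrow> x \<notin> set_uprod e" "\<And>w. w \<in> set vs \<Longrightarrow> w < x" "vs \<noteq> []"
  shows "\<exists>w\<in>set vs. depth (add_vertex G x vs) x = Suc (depth G w)"
proof -
  have "{v. v < x \<and> Upair x v \<in># medges (add_vertex G x vs)} = set vs"
    using assms(1)[of "Upair x _"] assms(2) by (auto simp: add_vertex_def)
  then have "depth (add_vertex G x vs) x
      = Max (insert 0 ((\<lambda>v. Suc (depth (add_vertex G x vs) v)) ` set vs))"
    by (simp add: depth.simps[of _ x])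
  also have "(\<lambda>v. Suc (depth (add_vertex G x vs) v)) ` set vs = (\<lambda>v. Suc (depth G v)) ` set vs"
    using assms(2) by (intro image_cong) (auto simp: depth_add_vertex_old)
  also have "Max (insert 0 \<dots>) = Max \<dots>" using assms(3) by simp
  also have "\<dots> \<in> (\<lambda>v. Suc (depth G v)) ` set vs" using assms(3) by (intro Max_in) auto
  finally show ?thesis by auto
qed

section \<open>The exponential potential\<close>

definition potential :: "nat multigraph \<Rightarrow> real" where
  "potential G = (\<Sum>u\<in>mverts G. real (mdeg G u) * exp (real (depth G u)))"

lemma potential_nonneg: "potential G \<ge> 0"
  unfolding potential_def by (intro sum_nonneg) auto

lemma mdeg_add_vertex_old:
  assumes "u \<noteq> x"
  shows "mdeg (add_vertex G x vs) u = mdeg G u + count_list vs u"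
proof -
  have "size {#e \<in># mset (map (Upair x) vs). u \<in> set_uprod e#} = count_list vs u"
    using assms by (induction vs) auto
  then show ?thesis by (simp add: mdeg_def add_vertex_def)
qed

lemma mdeg_add_vertex_new:
  assumes "\<And>e. e \<in># medges G \<Longrightarrow> x \<notin> set_uprod e"
  shows "mdeg (add_vertex G x vs) x = length vs"
proof -
  have "size {#e \<in># mset (map (Upair x) vs). x \<in> set_uprod e#} = length vs"
    by (induction vs) auto
  moreover have "{#e \<in># medges G. x \<in> set_uprod e#} = {#}"
    using assms by (intro multiset_eqI) (auto simp: count_eq_zero_iff)
  ultimately show ?thesis by (simp add: mdeg_def add_vertex_def)
qed

lemma sum_count_list_mult:
  fixes f :: "'a \<Rightarrow> real"
  assumes "finite V" "set vs \<subseteq> V"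
  shows "(\<Sum>u\<in>V. real (count_list vs u) * f u) = (\<Sum>w\<leftarrow>vs. f w)"
  using assms(2)
proof (induction vs)
  case Nil
  then show ?case by simp
next
  case (Cons a vs)
  have "(\<Sum>u\<in>V. real (count_list (a # vs) u) * f u)
      = (\<Sum>u\<in>V. (if u = a then f u else 0) + real (count_list vs u) * f u)"
    by (intro sum.cong) (auto simp: algebra_simps)
  also have "\<dots> = f a + (\<Sum>w\<leftarrow>vs. f w)"
    using Cons assms(1) by (simp add: sum.distrib)
  finally show ?case by simp
qed

text \<open>The maximal depth among the choices is exchanged for a sum over the choices, so that the
  right-hand side is linear in the law of a single choice.\<close>

lemma potential_add_vertex_le:
  assumes fin: "finite (mverts G)"
    and edges: "\<And>e. e \<in># medges G \<Longrightarrow> set_uprod e \<subseteq> mverts G"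
    and less: "\<And>u. u \<in> mverts G \<Longrightarrow> u < x"
    and vs: "set vs \<subseteq> mverts G" "vs \<noteq> []"
  shows "potential (add_vertex G x vs)
    \<le> potential G + (1 + real (length vs) * exp 1) * (\<Sum>w\<leftarrow>vs. exp (real (depth G w)))"
proof -
  let ?G' = "add_vertex G x vs"
  let ?f = "\<lambda>u. exp (real (depth G u))"
  let ?S = "\<Sum>w\<leftarrow>vs. ?f w"
  have fresh: "x \<notin> set_uprod e" if "e \<in># medges G" for e
    using edges[OF that] less by blast
  have vs_less: "w < x" if "w \<in> set vs" for w using that vs(1) less by blast
  obtain w where w: "w \<in> set vs" "depth ?G' x = Suc (depth G w)"
    using depth_add_vertex_new[of G x vs, OF fresh vs_less vs(2)] by blast
  have "?f w \<le> ?S" using w(1) by (intro member_le_sum_list) auto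
  then have top: "exp (real (depth ?G' x)) \<le> exp 1 * ?S"
    by (simp add: w(2) exp_add)
  have "(\<Sum>u\<in>mverts G. real (mdeg ?G' u) * exp (real (depth ?G' u)))
      = (\<Sum>u\<in>mverts G. real (mdeg G u) * ?f u + real (count_list vs u) * ?f u)"
  proof (intro sum.cong refl)
    fix u assume "u \<in> mverts G"
    then have "u < x" by (rule less)
    then show "real (mdeg ?G' u) * exp (real (depth ?G' u))
        = real (mdeg G u) * ?f u + real (count_list vs u) * ?f u"
      by (simp add: mdeg_add_vertex_old depth_add_vertex_old distrib_right)
  qed
  also have "\<dots> = potential G + ?S"
    by (simp add: sum.distrib potential_def sum_count_list_mult[OF fin vs(1)])
  finally have old: "(\<Sum>u\<in>mverts G. real (mdeg ?G' u) * exp (real (depth ?G' u)))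
      = potential G + ?S" .
  have "mverts ?G' = insert x (mverts G)" by (simp add: add_vertex_def)
  moreover have "x \<notin> mverts G" using less by blast
  ultimately have "potential ?G' = real (length vs) * exp (real (depth ?G' x)) + (potential G + ?S)"
    using fin old mdeg_add_vertex_new[of G x vs, OF fresh] by (simp add: potential_def[of ?G'])
  also have "\<dots> \<le> real (length vs) * (exp 1 * ?S) + (potential G + ?S)"
    using top by (intro add_right_mono mult_left_mono) auto
  finally show ?thesis by (simp add: algebra_simps)
qed

section \<open>Expected growth of the potential\<close>

lemma nn_integral_choose_nbr:
  assumes fin: "finite (mverts G)" and pos: "(\<Sum>u\<in>mverts G. mdeg G u) > 0"
    and f: "\<And>u. f u \<ge> 0"
  shows "(\<integral>\<^sup>+w. ennreal (f w) \<partial>measure_pmf (choose_nbr G))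
    = ennreal ((\<Sum>u\<in>mverts G. real (mdeg G u) * f u) / real (\<Sum>u\<in>mverts G. mdeg G u))"
proof -
  let ?s = "real (\<Sum>u\<in>mverts G. mdeg G u)"
  have "set_pmf (choose_nbr G) \<subseteq> mverts G"
    by (auto simp: set_pmf_iff pmf_choose_nbr[OF fin pos] split: if_splits)
  then have "(\<integral>\<^sup>+w. ennreal (f w) \<partial>measure_pmf (choose_nbr G))
      = (\<Sum>w\<in>mverts G. ennreal (f w) * ennreal (pmf (choose_nbr G) w))"
    using fin by (subst nn_integral_measure_pmf_support[of "mverts G"]) auto
  also have "\<dots> = (\<Sum>w\<in>mverts G. ennreal (real (mdeg G w) * f w / ?s))"
    using f by (intro sum.cong refl)
      (simp add: pmf_choose_nbr[OF fin pos] ennreal_mult'[symmetric] mult.commute del: of_nat_sum)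
  also have "\<dots> = ennreal (\<Sum>w\<in>mverts G. real (mdeg G w) * f w / ?s)"
    using f by (intro sum_ennreal) (simp add: sum_nonneg)
  finally show ?thesis by (simp add: sum_divide_distrib)
qed

lemma nn_integral_replicate_pmf_sum_list:
  fixes f :: "'a \<Rightarrow> ennreal"
  shows "(\<integral>\<^sup>+vs. (\<Sum>w\<leftarrow>vs. f w) \<partial>measure_pmf (replicate_pmf k p))
    = of_nat k * (\<integral>\<^sup>+w. f w \<partial>measure_pmf p)"
proof (induction k)
  case 0
  then show ?case by simp
next
  case (Suc k)
  then show ?case
    by (simp add: nn_integral_add distrib_right)
qed

text \<open>The total degree is \<open>m (2n - 1)\<close> for a graph on \<open>n\<close> vertices, so the \<open>m\<close> choices
  together contribute \<open>\<Phi>(G) / (2n - 1)\<close> on average: the number of choices cancels, and it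
  enters the growth factor only through the degree \<open>m\<close> of the new vertex.\<close>

lemma expected_potential_step:
  assumes m: "m \<ge> 1" and G: "G \<in> set_pmf (pref_attach m (Suc n))"
  shows "(\<integral>\<^sup>+vs. ennreal (potential (add_vertex G (Suc (Suc n)) vs))
        \<partial>measure_pmf (replicate_pmf m (choose_nbr G)))
    \<le> ennreal ((1 + (1 + real m * exp 1) / (2 * real (Suc n) - 1)) * potential G)"
proof -
  let ?p = "choose_nbr G" and ?f = "\<lambda>u. exp (real (depth G u))"
  let ?a = "1 + real m * exp 1" and ?d = "2 * real (Suc n) - 1"
  note supp = pref_attach_support[OF m G]
  have fin: "finite (mverts G)" using supp(1) by simp
  have total: "real (\<Sum>u\<in>mverts G. mdeg G u) = real m * ?d"
    unfolding supp(3) by (simp add: of_nat_diff algebra_simps)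
  then have "real (\<Sum>u\<in>mverts G. mdeg G u) > 0" using m by simp
  then have pos: "(\<Sum>u\<in>mverts G. mdeg G u) > 0" by (simp only: of_nat_0_less_iff)
  have "set_pmf ?p \<subseteq> mverts G"
    by (auto simp: set_pmf_iff pmf_choose_nbr[OF fin pos] split: if_splits)
  then have vs: "set vs \<subseteq> mverts G" "length vs = m"
    if "vs \<in> set_pmf (replicate_pmf m ?p)" for vs
    using that by (auto simp: set_replicate_pmf)
  have "(\<integral>\<^sup>+vs. ennreal (potential (add_vertex G (Suc (Suc n)) vs))
        \<partial>measure_pmf (replicate_pmf m ?p))
      \<le> (\<integral>\<^sup>+vs. ennreal (potential G) + ennreal ?a * (\<Sum>w\<leftarrow>vs. ennreal (?f w))
        \<partial>measure_pmf (replicate_pmf m ?p))"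
  proof (intro nn_integral_mono_AE AE_pmfI)
    fix vs assume v: "vs \<in> set_pmf (replicate_pmf m ?p)"
    have sum: "(\<Sum>w\<leftarrow>vs. ?f w) \<ge> 0" by (rule sum_list_nonneg) auto
    have "potential (add_vertex G (Suc (Suc n)) vs)
        \<le> potential G + (1 + real (length vs) * exp 1) * (\<Sum>w\<leftarrow>vs. ?f w)"
      using vs[OF v] m supp by (intro potential_add_vertex_le) auto
    then show "ennreal (potential (add_vertex G (Suc (Suc n)) vs))
        \<le> ennreal (potential G) + ennreal ?a * (\<Sum>w\<leftarrow>vs. ennreal (?f w))"
      using sum vs(2)[OF v]
      by (simp add: ennreal_mult[symmetric] ennreal_plus[symmetric] potential_nonneg
          ennreal_leI del: ennreal_plus)
  qed
  also have "\<dots> = ennreal (potential G)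
      + ennreal ?a * (of_nat m * (\<integral>\<^sup>+w. ennreal (?f w) \<partial>measure_pmf ?p))"
    by (simp add: nn_integral_add nn_integral_cmult nn_integral_replicate_pmf_sum_list
        del: sum_list_ennreal)
  also have "(\<integral>\<^sup>+w. ennreal (?f w) \<partial>measure_pmf ?p) = ennreal (potential G / (real m * ?d))"
    by (subst nn_integral_choose_nbr[OF fin pos]) (simp_all only: total potential_def exp_ge_zero)
  also have "ennreal (potential G) + ennreal ?a * (of_nat m * \<dots>)
      = ennreal (potential G + ?a * (real m * (potential G / (real m * ?d))))"
    using potential_nonneg[of G]
    by (simp add: ennreal_mult[symmetric] ennreal_of_nat_eq_real_of_nat
        ennreal_plus[symmetric] del: ennreal_plus)
  also have "potential G + ?a * (real m * (potential G / (real m * ?d)))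
      = (1 + ?a / ?d) * potential G"
    using m by (simp add: divide_simps) (simp add: algebra_simps)
  finally show ?thesis .
qed

text \<open>Bernoulli's inequality \<open>1 + k / n \<le> (1 + 1 / n)\<^sup>k\<close> turns the growth factor of one step into
  a telescoping product; \<open>e \<le> 3\<close> makes the exponent \<open>k\<close> an integer, and the factor 2 lost by
  \<open>n \<le> 2n - 1\<close> affects only the constant.\<close>

lemma growth_factor_le:
  "1 + (1 + real m * exp 1) / (2 * real (Suc n) - 1)
    \<le> real (Suc (Suc n)) ^ (1 + 3 * m) / real (Suc n) ^ (1 + 3 * m)"
proof -
  have "1 + (1 + real m * exp 1) / (2 * real (Suc n) - 1)
      \<le> 1 + (1 + real m * 3) / real (Suc n)"
    using exp_le by (intro add_left_mono frac_le) (auto intro!: mult_left_mono)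
  also have "\<dots> = 1 + real (1 + 3 * m) * (1 / real (Suc n))" by simp
  also have "\<dots> \<le> (1 + 1 / real (Suc n)) ^ (1 + 3 * m)"
    by (rule Bernoulli_inequality) (simp add: order.trans[of _ 0])
  also have "1 + 1 / real (Suc n) = real (Suc (Suc n)) / real (Suc n)"
    by (simp add: field_simps)
  finally show ?thesis by (simp only: power_divide)
qed

lemma expected_potential_le:
  assumes m: "m \<ge> 1"
  shows "(\<integral>\<^sup>+G. ennreal (potential G) \<partial>measure_pmf (pref_attach m (Suc n)))
    \<le> ennreal (real m * real (Suc n) ^ (1 + 3 * m))"
proof (induction n)
  case 0
  let ?G = "\<lparr>mverts = {1}, medges = replicate_mset m (Upair 1 1)\<rparr> :: nat multigraph"
  have "{v. v < 1 \<and> Upair 1 v \<in># medges ?G} = {}" by (auto simp: in_replicate_mset)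
  then have "depth ?G 1 = 0" unfolding depth.simps[of ?G 1] by (simp only: image_empty Max_singleton)
  moreover have "mdeg ?G 1 = m"
    by (simp add: mdeg_def flip: mset_replicate mset_filter)
  ultimately have "potential ?G = real m" by (simp add: potential_def)
  then show ?case by simp
next
  case (Suc n)
  let ?c = "1 + (1 + real m * exp 1) / (2 * real (Suc n) - 1)"
  have c: "?c \<ge> 0" by simp
  have "(\<integral>\<^sup>+G. ennreal (potential G) \<partial>measure_pmf (pref_attach m (Suc (Suc n))))
      = (\<integral>\<^sup>+G. (\<integral>\<^sup>+vs. ennreal (potential (add_vertex G (Suc (Suc n)) vs))
        \<partial>measure_pmf (replicate_pmf m (choose_nbr G))) \<partial>measure_pmf (pref_attach m (Suc n)))"
    by simp
  also have "\<dots> \<le> (\<integral>\<^sup>+G. ennreal (?c * potential G) \<partial>measure_pmf (pref_attach m (Suc n)))"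
    by (intro nn_integral_mono_AE AE_pmfI expected_potential_step[OF m])
  also have "\<dots> = ennreal ?c * (\<integral>\<^sup>+G. ennreal (potential G) \<partial>measure_pmf (pref_attach m (Suc n)))"
    unfolding ennreal_mult'[OF c] by (rule nn_integral_cmult) simp
  also have "\<dots> \<le> ennreal ?c * ennreal (real m * real (Suc n) ^ (1 + 3 * m))"
    by (intro mult_left_mono Suc) auto
  also have "\<dots> = ennreal (?c * (real m * real (Suc n) ^ (1 + 3 * m)))"
    using c by (simp only: ennreal_mult')
  also have "\<dots> \<le> ennreal (real (Suc (Suc n)) ^ (1 + 3 * m) / real (Suc n) ^ (1 + 3 * m)
      * (real m * real (Suc n) ^ (1 + 3 * m)))"
    by (intro ennreal_leI mult_right_mono growth_factor_le) auto
  also have "real (Suc (Suc n)) ^ (1 + 3 * m) / real (Suc n) ^ (1 + 3 * m)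
      * (real m * real (Suc n) ^ (1 + 3 * m)) = real m * real (Suc (Suc n)) ^ (1 + 3 * m)"
    by (simp del: of_nat_Suc power_Suc)
  finally show ?case .
qed

section \<open>Tail bound for the height\<close>

text \<open>Degrees start at \<open>m\<close> and never decrease. This is what makes every vertex, hence every path,
  visible in the degree-weighted potential.\<close>

lemma mdeg_pos:
  assumes m: "m \<ge> 1" and "G \<in> set_pmf (pref_attach m (Suc n))" "u \<in> mverts G"
  shows "mdeg G u > 0"
  using assms(2,3)
proof (induction n arbitrary: G u)
  case 0
  then show ?case using m by (auto simp: mdeg_def simp flip: mset_replicate mset_filter)
next
  case (Suc n)
  obtain H vs where H: "H \<in> set_pmf (pref_attach m (Suc n))"
    and vs: "vs \<in> set_pmf (replicate_pmf m (choose_nbr H))"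
    and G: "G = add_vertex H (Suc (Suc n)) vs"
    using Suc.prems(1) by auto
  note supp = pref_attach_support[OF m H]
  show ?case
  proof (cases "u = Suc (Suc n)")
    case True
    have "Suc (Suc n) \<notin> set_uprod e" if "e \<in># medges H" for e
      using supp(1) supp(2)[OF that] by auto
    then show ?thesis
      using True vs m by (simp add: G mdeg_add_vertex_new set_replicate_pmf)
  next
    case False
    then have "u \<in> mverts H" using Suc.prems(2) by (simp add: G add_vertex_def)
    with Suc.IH[OF H this] show ?thesis using False by (simp add: G mdeg_add_vertex_old)
  qed
qed

lemma exp_dag_height_le_potential:
  assumes m: "m \<ge> 1" and G: "G \<in> set_pmf (pref_attach m (Suc n))"
  shows "exp (real (dag_height (DAG G))) \<le> potential G"
proof -
  note supp = pref_attach_support[OF m G]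
  have fin: "finite (mverts G)" and ne: "mverts G \<noteq> {}" using supp(1) by auto
  obtain u where u: "u \<in> mverts G" "dag_height (DAG G) \<le> depth G u"
    using dag_height_le_depth[OF fin_digraph_DAG[OF fin supp(2)] ne] by blast
  have "exp (real (dag_height (DAG G))) \<le> 1 * exp (real (depth G u))" using u(2) by simp
  also have "\<dots> \<le> real (mdeg G u) * exp (real (depth G u))"
    using mdeg_pos[OF m G u(1)] by (intro mult_right_mono) auto
  also have "\<dots> \<le> potential G"
    unfolding potential_def using u(1) fin by (intro member_le_sum) auto
  finally show ?thesis .
qed

lemma prob_dag_height_gt_le:
  assumes m: "m \<ge> 1" and n: "n \<ge> 1"
  shows "measure_pmf.prob (pref_attach m n)
    {G. real (dag_height (DAG G)) > 6 * real m * ln (real n)} \<le> real m / real n ^ 2"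
proof -
  obtain k where k: "n = Suc k" using n by (cases n) auto
  let ?P = "pref_attach m n" and ?A = "{G. real (dag_height (DAG G)) > 6 * real m * ln (real n)}"
  let ?L = "real n ^ (6 * m)"
  have L: "?L > 0" using n by simp
  have exp_L: "exp (6 * real m * ln (real n)) = ?L"
    using n by (simp add: exp_of_nat_mult[of "6 * m", simplified])
  have "ennreal (measure_pmf.prob ?P ?A) = (\<integral>\<^sup>+G. indicator ?A G \<partial>measure_pmf ?P)"
    by (simp add: measure_pmf.emeasure_eq_measure)
  also have "\<dots> \<le> (\<integral>\<^sup>+G. ennreal (1 / ?L) * ennreal (potential G) \<partial>measure_pmf ?P)"
  proof (intro nn_integral_mono_AE AE_pmfI)
    fix G assume G: "G \<in> set_pmf ?P"
    have "1 \<le> 1 / ?L * potential G" if "G \<in> ?A"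
    proof -
      have "?L \<le> exp (real (dag_height (DAG G)))"
        using that by (simp flip: exp_L)
      also have "\<dots> \<le> potential G" using exp_dag_height_le_potential m G k by blast
      finally show ?thesis using L by (simp add: field_simps)
    qed
    then show "indicator ?A G \<le> ennreal (1 / ?L) * ennreal (potential G)"
      by (auto simp: indicator_def ennreal_mult'[symmetric] simp del: times_divide_eq_left)
  qed
  also have "\<dots> = ennreal (1 / ?L) * (\<integral>\<^sup>+G. ennreal (potential G) \<partial>measure_pmf ?P)"
    by (simp add: nn_integral_cmult)
  also have "\<dots> \<le> ennreal (1 / ?L) * ennreal (real m * real n ^ (1 + 3 * m))"
    unfolding k by (intro mult_left_mono expected_potential_le m) auto
  also have "\<dots> = ennreal (real m * (real n ^ (1 + 3 * m) / ?L))"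
    by (simp add: ennreal_mult'[symmetric])
  also have "\<dots> \<le> ennreal (real m * (1 / real n ^ 2))"
  proof (intro ennreal_leI mult_left_mono)
    \<comment> \<open>The constant 6 is chosen so that \<open>1 + 3 m + 2 \<le> 6 m\<close> for all \<open>m \<ge> 1\<close>.\<close>
    have "real n ^ (1 + 3 * m) * real n ^ 2 \<le> ?L"
      unfolding power_add[symmetric] using m n by (intro power_increasing) auto
    then show "real n ^ (1 + 3 * m) / ?L \<le> 1 / real n ^ 2"
      using n L by (simp add: field_simps)
  qed auto
  finally show ?thesis by simp
qed

theorem theorem3:
  shows "\<exists>C::real. C > 0 \<and> (\<forall>m::nat. m \<ge> 1 \<longrightarrow>
    (\<exists>\<epsilon>::nat \<Rightarrow> real. \<epsilon> \<in> o(\<lambda>n. 1 / real n) \<and>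
      (\<forall>n\<ge>1. measure_pmf.prob (pref_attach m n)
          {G. real (dag_height (DAG G)) \<le> C * real m * ln (real n)} \<ge> 1 - \<epsilon> n)))"
proof (intro exI[of _ 6] conjI allI impI)
  fix m :: nat assume m: "m \<ge> 1"
  have "(\<lambda>n. real m / real n ^ 2) \<in> o(\<lambda>n. 1 / real n)"
    by real_asymp
  moreover have "measure_pmf.prob (pref_attach m n)
      {G. real (dag_height (DAG G)) \<le> 6 * real m * ln (real n)} \<ge> 1 - real m / real n ^ 2"
    if "n \<ge> 1" for n
  proof -
    let ?B = "{G. real (dag_height (DAG G)) \<le> 6 * real m * ln (real n)}"
    have "measure_pmf.prob (pref_attach m n) (- ?B) \<le> real m / real n ^ 2"
      using prob_dag_height_gt_le[OF m that] by (simp add: Collect_neg_eq[symmetric] not_le)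
    then show ?thesis
      using measure_pmf.prob_compl[of ?B "pref_attach m n"] by (simp add: Compl_eq_Diff_UNIV)
  qed
  ultimately show "\<exists>\<epsilon>::nat \<Rightarrow> real. \<epsilon> \<in> o(\<lambda>n. 1 / real n) \<and>
      (\<forall>n\<ge>1. measure_pmf.prob (pref_attach m n)
          {G. real (dag_height (DAG G)) \<le> 6 * real m * ln (real n)} \<ge> 1 - \<epsilon> n)"
    by (intro exI[of _ "\<lambda>n. real m / real n ^ 2"]) auto
qed simp

end
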